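(* Let $n\ge 3$ and let $x_1,\ldots,x_n\in\mathbb{R}^3$ be the vertices of a regular $n$-gon. Then $$|D(x_1,\ldots,x_n)| = n^{n/2}\,2^{n(1-n)/2}\prod_{1\le k\le n/2}\left(\cot\frac{\pi k}{2n}\right)^{n-2k}.$$
   Context: Here $D$ denotes the Atiyah determinant, defined as follows. Let $x_1,\ldots,x_n$ be distinct points of $\mathbb{R}^3$, with $x_i=(x_{i,1},x_{i,2},x_{i,3})$. For each pair $i<j$ choose complex numbers $z_{i,j},w_{i,j}$ with $|z_{i,j}|^2+|w_{i,j}|^2=1$ and $$\frac{z_{i,j}}{w_{i,j}}=\frac{(x_{j,1}-x_{i,1})+(x_{j,2}-x_{i,2})\sqrt{-1}}{\sqrt{\sum_{k=1}^3(x_{j,k}-x_{i,k})^2}-(x_{j,3}-x_{i,3})},$$ with the convention that $w_{i,j}=0$ when the denominator of the right-hand side vanishes. For $i>j$ put $z_{i,j}=-\overline{w_{j,i}}$ and $w_{i,j}=\overline{z_{j,i}}$. Let $a_{i,j}$ be the coefficient of $t_1^{j-1}t_2^{n-j}$ in the polynomial $f_i(t_1,t_2)=\prod_{k\ne i}(z_{i,k}t_1-w_{i,k}t_2)$. Then $D(x_1,\ldots,x_n)=\det(a_{i,j})_{1\le i,j\le n}$; this number is known to be independent of the choices made. *)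

theory Defs
  imports "HOL-Analysis.Analysis" "Jordan_Normal_Form.Determinant"
begin

text \<open>Points are indexed by \<open>{1..n}\<close>. The \<open>z\<close>, \<open>w\<close> are only determined up to a common phase for each
  pair \<open>i < j\<close>. Since \<open>a / 0 = 0\<close> in HOL, the clause \<open>w i j \<noteq> 0\<close> is needed: when
  \<open>x j - x i\<close> points in the direction of the negative third axis the ratio is \<open>0\<close>, and
  \<open>w i j = 0\<close> would otherwise satisfy the equation as well.\<close>

definition atiyah_choice ::
  "nat \<Rightarrow> (nat \<Rightarrow> real^3) \<Rightarrow> (nat \<Rightarrow> nat \<Rightarrow> complex) \<Rightarrow> (nat \<Rightarrow> nat \<Rightarrow> complex) \<Rightarrow> bool" where
  "atiyah_choice n x z w \<longleftrightarrow>
     (\<forall>i\<in>{1..n}. \<forall>j\<in>{1..n}. i < j \<longrightarrow>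
        (cmod (z i j))\<^sup>2 + (cmod (w i j))\<^sup>2 = 1 \<and>
        (let d = sqrt (\<Sum>k\<in>UNIV. (x j $ k - x i $ k)\<^sup>2) - (x j $ 3 - x i $ 3) in
           if d = 0 then w i j = 0
           else w i j \<noteq> 0 \<and>
                z i j / w i j = Complex (x j $ 1 - x i $ 1) (x j $ 2 - x i $ 2) / complex_of_real d) \<and>
        z j i = - cnj (w i j) \<and>
        w j i = cnj (z i j))"

text \<open>Bivariate polynomials are of type \<open>complex poly poly\<close>: the outer variable is \<open>t\<^sub>1\<close> and the
  inner one (of the coefficients) is \<open>t\<^sub>2\<close>, so each factor below is \<open>z i k * t\<^sub>1 - w i k * t\<^sub>2\<close>.\<close>

definition atiyah_poly ::
  "nat \<Rightarrow> (nat \<Rightarrow> nat \<Rightarrow> complex) \<Rightarrow> (nat \<Rightarrow> nat \<Rightarrow> complex) \<Rightarrow> nat \<Rightarrow> complex poly poly" where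
  "atiyah_poly n z w i = (\<Prod>k\<in>{1..n} - {i}. [: [:0, - w i k:], [:z i k:] :])"

definition atiyah_coeff ::
  "nat \<Rightarrow> (nat \<Rightarrow> nat \<Rightarrow> complex) \<Rightarrow> (nat \<Rightarrow> nat \<Rightarrow> complex) \<Rightarrow> nat \<Rightarrow> nat \<Rightarrow> complex" where
  "atiyah_coeff n z w i j = coeff (coeff (atiyah_poly n z w i) (j - 1)) (n - j)"

text \<open>Matrices of \<open>Jordan_Normal_Form\<close> are indexed from \<open>0\<close>, whence the shift. For distinct points
  \<open>x\<close> and any \<open>z\<close>, \<open>w\<close> with \<open>atiyah_choice n x z w\<close> this is the Atiyah determinant of \<open>x\<close>; it does
  not depend on the choice: changing the phase of the pair \<open>(i, j)\<close> scales row \<open>i\<close> by \<open>u\<close> and row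
  \<open>j\<close> by \<open>cnj u\<close>, with \<open>u\<close> of modulus \<open>1\<close>.\<close>

definition atiyah_det ::
  "nat \<Rightarrow> (nat \<Rightarrow> nat \<Rightarrow> complex) \<Rightarrow> (nat \<Rightarrow> nat \<Rightarrow> complex) \<Rightarrow> complex" where
  "atiyah_det n z w =
     Determinant.det (Matrix.mat n n (\<lambda>(i, j). atiyah_coeff n z w (Suc i) (Suc j)))"

lemma atiyah_choice_exists: "\<exists>z w. atiyah_choice n x z w"
proof -
  define d where
    "d i j = sqrt (\<Sum>k\<in>UNIV. (x j $ k - x i $ k)\<^sup>2) - (x j $ 3 - x i $ 3)" for i j
  define q where
    "q i j = Complex (x j $ 1 - x i $ 1) (x j $ 2 - x i $ 2) / complex_of_real (d i j)" for i j
  define w0 where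
    "w0 i j = (if d i j = 0 then 0 else complex_of_real (1 / sqrt (1 + (cmod (q i j))\<^sup>2)))" for i j
  define z0 where "z0 i j = (if d i j = 0 then 1 else q i j * w0 i j)" for i j
  define z where "z i j = (if i < j then z0 i j else - cnj (w0 j i))" for i j
  define w where "w i j = (if i < j then w0 i j else cnj (z0 j i))" for i j
  have pos: "1 + (cmod (q i j))\<^sup>2 > 0" for i j
    by (simp add: add_pos_nonneg)
  have w0_nz: "w0 i j \<noteq> 0" if "d i j \<noteq> 0" for i j
    using that pos[of i j] by (simp add: w0_def)
  have unit: "(cmod (z0 i j))\<^sup>2 + (cmod (w0 i j))\<^sup>2 = 1" for i j
  proof (cases "d i j = 0")
    case True
    then show ?thesis by (simp add: z0_def w0_def)
  next
    case False
    have w2: "(cmod (w0 i j))\<^sup>2 = 1 / (1 + (cmod (q i j))\<^sup>2)"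
      using False pos[of i j] by (simp add: w0_def norm_divide power_divide)
    have "(cmod (z0 i j))\<^sup>2 + (cmod (w0 i j))\<^sup>2 = (1 + (cmod (q i j))\<^sup>2) * (cmod (w0 i j))\<^sup>2"
      using False by (simp add: z0_def norm_mult power_mult_distrib algebra_simps)
    then show ?thesis
      using w2 pos[of i j] by simp
  qed
  have "atiyah_choice n x z w"
    unfolding atiyah_choice_def Let_def d_def[symmetric] q_def[symmetric]
    using unit w0_nz by (auto simp: z_def w_def z0_def w0_def)
  then show ?thesis by blast
qed

text \<open>The points \<open>x 1, \<dots>, x n\<close> are, in some order, \<open>n\<close> equally spaced points of a circle with centre
  \<open>c\<close> and radius \<open>r\<close> in the plane through \<open>c\<close> spanned by the orthonormal vectors \<open>u\<close>, \<open>v\<close>.\<close>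

definition regular_polygon_vertices :: "nat \<Rightarrow> (nat \<Rightarrow> real^3) \<Rightarrow> bool" where
  "regular_polygon_vertices n x \<longleftrightarrow>
     (\<exists>c u v r. norm u = 1 \<and> norm v = 1 \<and> inner u v = 0 \<and> r > 0 \<and>
        x ` {1..n} =
        (\<lambda>k::nat. c + r *\<^sub>R (cos (2 * pi * real k / real n) *\<^sub>R u
                          + sin (2 * pi * real k / real n) *\<^sub>R v)) ` {1..n})"

end

theory Submission imports Defs
begin

text \<open>
  A unit vector \<open>(z, w)\<close> of \<open>\<complex>\<^sup>2\<close>, up to phase, is the same thing as a direction in space (the Hopf map),
  and row \<open>i\<close> of the Atiyah matrix lists the coefficients of a binary form whose linear factors are the
  spinors of the directions from \<open>x i\<close> to the other points. For a regular polygon all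
  these directions lie in one plane, so in a basis of \<open>\<complex>\<^sup>2\<close> adapted to that plane (\<open>spinor_frame\<close>)
  each factor is, up to phase, \<open>(E X + Y) / sqrt 2\<close> with \<open>E\<close> the direction regarded as a complex number of
  modulus 1. Here \<open>X\<close> and \<open>Y\<close> are two fixed linear forms. Passing to them is a linear
  substitution whose determinant has modulus 1, and such a substitution does not change the
  modulus of the determinant of \<open>n\<close> binary forms of degree \<open>n - 1\<close> (\<open>det_coeff_mat_moebius\<close>).

  With \<open>q = cis (pi / n)\<close> the vertices are, up to position and scale, the numbers
  \<open>q ^ (2 * k)\<close>, and the directions out of vertex \<open>k\<close>
  are \<open>\<i> * q ^ (2 * k) * q ^ m\<close> for \<open>0 < m < n\<close> (\<open>prod_root_differences\<close>). So every row is, up to a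
  factor of modulus \<open>2 powr (- (n - 1) / 2)\<close>, the form \<open>Y ^ (n - 1)\<close> times the polynomial \<open>\<Prod>m. 1 + q ^ m * T\<close> at
  \<open>T = \<i> * q ^ (2 * k) * X / Y\<close>. In the variables \<open>X\<close> and \<open>Y\<close> the matrix is therefore a discrete Fourier
  matrix with rescaled rows and columns. The Fourier matrix contributes \<open>n powr (n / 2)\<close>
  (\<open>cmod_det_vandermonde_roots_of_unity\<close>), the rows contribute the power of 2, and the columns contribute the
  coefficients of the polynomial. By the \<open>q\<close>-binomial theorem these are, in modulus,
  products of \<open>sin (pi * (n - m) / (2 * n)) / sin (pi * m / (2 * n))\<close>, which is the cotangent of
  \<open>pi * m / (2 * n)\<close> (\<open>cmod_coeff_gauss_poly\<close>). Pairing \<open>m\<close> with \<open>n - m\<close>, whose cotangents are reciprocal,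
  gives the stated exponents \<open>n - 2 * k\<close>.
\<close>

section \<open>Determinants of coefficient matrices\<close>

definition coeff_mat :: "nat \<Rightarrow> (nat \<Rightarrow> 'a::comm_ring_1 poly) \<Rightarrow> 'a mat" where
  "coeff_mat n F = Matrix.mat n n (\<lambda>(i, j). coeff (F i) j)"

definition vandermonde :: "nat \<Rightarrow> (nat \<Rightarrow> 'a::comm_ring_1) \<Rightarrow> 'a mat" where
  "vandermonde n t = Matrix.mat n n (\<lambda>(i, j). t i ^ j)"

lemma poly_eq_sum_lessThan:
  fixes p :: "'a::comm_ring_1 poly"
  assumes "degree p < n"
  shows "poly p t = (\<Sum>j<n. coeff p j * t ^ j)"
proof -
  have "(\<Sum>j<n. coeff p j * t ^ j) = (\<Sum>j\<le>degree p. coeff p j * t ^ j)"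
    by (rule sum.mono_neutral_right) (use assms in \<open>auto simp: coeff_eq_0\<close>)
  then show ?thesis by (simp add: poly_altdef)
qed

text \<open>Evaluation at \<open>t j\<close> is the product of the coefficient vector with column \<open>j\<close> of the transposed
  Vandermonde matrix. Determinants of forms can therefore be compared through their values at \<open>n\<close> points.\<close>

lemma det_poly_values:
  fixes F :: "nat \<Rightarrow> 'a::comm_ring_1 poly"
  assumes "\<And>i. i < n \<Longrightarrow> degree (F i) < n"
  shows "Determinant.det (Matrix.mat n n (\<lambda>(i, j). poly (F i) (t j))) =
    Determinant.det (coeff_mat n F) * Determinant.det (vandermonde n t)"
proof -
  have "Matrix.mat n n (\<lambda>(i, j). poly (F i) (t j)) = coeff_mat n F * transpose_mat (vandermonde n t)"
    using assms
    by (intro eq_matI)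
      (auto simp: coeff_mat_def vandermonde_def scalar_prod_def poly_eq_sum_lessThan[where n = n] lessThan_atLeast0
        intro!: sum.cong)
  moreover have "vandermonde n t \<in> carrier_mat n n" "coeff_mat n F \<in> carrier_mat n n"
    by (simp_all add: vandermonde_def coeff_mat_def)
  ultimately show ?thesis
    by (simp add: det_mult[of _ n] det_transpose[of _ n])
qed

text \<open>For the Newton basis \<open>\<Prod>i<j. X - t i\<close> the coefficient matrix is unitriangular and
  the matrix of values is triangular, so the determinant can be read off the diagonal.\<close>

lemma det_vandermonde:
  fixes t :: "nat \<Rightarrow> 'a::idom"
  shows "Determinant.det (vandermonde n t) = (\<Prod>j<n. \<Prod>i<j. t j - t i)"
proof -
  define N where "N j = (\<Prod>i<j. [:- t i, 1:])" for j
  have deg: "degree (N j) = j" for j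
    unfolding N_def by (subst degree_prod_eq_sum_degree) auto
  have monic: "coeff (N j) j = 1" for j
    using lead_coeff_prod[of "\<lambda>i. [:- t i, 1:]" "{..<j}"] deg[of j] by (simp add: N_def)
  have val: "poly (N i) (t j) = (\<Prod>k<i. t j - t k)" for i j
    by (simp add: N_def poly_prod)
  have "Determinant.det (coeff_mat n N) = 1"
    by (subst det_lower_triangular[of n])
      (auto simp: coeff_mat_def prod_list_diag_prod monic coeff_eq_0 deg)
  moreover have "Determinant.det (Matrix.mat n n (\<lambda>(i, j). poly (N i) (t j))) = (\<Prod>j<n. \<Prod>i<j. t j - t i)"
  proof (subst det_upper_triangular[of _ n])
    show "upper_triangular (Matrix.mat n n (\<lambda>(i, j). poly (N i) (t j)))"
      by (rule upper_triangularI) (auto simp: val)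
  qed (auto simp: prod_list_diag_prod val lessThan_atLeast0)
  ultimately show ?thesis
    using det_poly_values[of n N t] by (simp add: deg)
qed

lemma prod_pairs_mult:
  fixes r :: "nat \<Rightarrow> 'a::comm_monoid_mult"
  shows "(\<Prod>j<n. \<Prod>i<j. r i * r j) = (\<Prod>j<n. r j ^ (n - 1))"
proof (induction n)
  case (Suc n)
  have "(\<Prod>j<n. r j ^ (n - 1)) * (\<Prod>j<n. r j) = (\<Prod>j<n. r j ^ n)"
    unfolding prod.distrib[symmetric]
    by (rule prod.cong) (auto simp: power_eq_if mult.commute)
  then show ?case
    using Suc by (simp add: prod.distrib mult_ac)
qed simp

lemma prod_pairs_const:
  fixes c :: "'a::comm_monoid_mult"
  shows "(\<Prod>j<n. \<Prod>i<j. c) = c ^ (n choose 2)"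
  by (induction n) (auto simp: power_add numeral_2_eq_2 mult.commute)

text \<open>A Moebius map multiplies each difference \<open>t j - t i\<close> by its determinant and divides it by the
  denominators at \<open>t i\<close> and \<open>t j\<close>; every denominator occurs in \<open>n - 1\<close> of the differences.\<close>

lemma det_vandermonde_moebius:
  fixes t :: "nat \<Rightarrow> 'a::field"
  assumes "\<And>i. i < n \<Longrightarrow> c * t i + d \<noteq> 0"
  shows "Determinant.det (vandermonde n (\<lambda>i. (a * t i + b) / (c * t i + d))) *
      (\<Prod>i<n. (c * t i + d) ^ (n - 1)) =
    (a * d - b * c) ^ (n choose 2) * Determinant.det (vandermonde n t)"
proof -
  have diff: "((a * t j + b) / (c * t j + d) - (a * t i + b) / (c * t i + d)) *
      ((c * t i + d) * (c * t j + d)) = (a * d - b * c) * (t j - t i)" if "i < n" "j < n" for i j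
    using assms[OF that(1)] assms[OF that(2)] by (simp add: divide_simps) (simp add: algebra_simps)
  show ?thesis
    unfolding det_vandermonde prod_pairs_mult[symmetric] prod_pairs_const[symmetric] prod.distrib[symmetric]
    by (intro prod.cong refl diff) auto
qed

text \<open>Invariance of the determinant of \<open>n\<close> binary forms of degree \<open>n - 1\<close> under a linear substitution, written in
  the inhomogeneous coordinate: \<open>F i\<close> is the form \<open>G i\<close> evaluated at \<open>(a t + b, c t + d)\<close>. Comparing the values at
  \<open>n\<close> points that avoid the pole reduces it to the behaviour of the Vandermonde determinant.\<close>

lemma det_coeff_mat_moebius:
  fixes F G :: "nat \<Rightarrow> 'a::field_char_0 poly"
  assumes degF: "\<And>i. i < n \<Longrightarrow> degree (F i) < n" and degG: "\<And>i. i < n \<Longrightarrow> degree (G i) < n"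
    and nz: "a * d - b * c \<noteq> 0"
    and FG: "\<And>i t. i < n \<Longrightarrow> c * t + d \<noteq> 0 \<Longrightarrow>
      poly (F i) t = (c * t + d) ^ (n - 1) * poly (G i) ((a * t + b) / (c * t + d))"
  shows "Determinant.det (coeff_mat n F) = (a * d - b * c) ^ (n choose 2) * Determinant.det (coeff_mat n G)"
proof -
  have "finite {t. c * t + d = 0}"
  proof (cases "c = 0")
    case False
    then have "{t. c * t + d = 0} \<subseteq> {- d / c}"
      by (auto simp: field_simps eq_neg_iff_add_eq_0)
    then show ?thesis by (rule finite_subset) simp
  qed (use nz in auto)
  then have "infinite (- {t. c * t + d = 0})"
    using infinite_UNIV_char_0 by (metis finite_compl)
  then obtain t :: "nat \<Rightarrow> 'a" where t: "inj t" "range t \<subseteq> - {t. c * t + d = 0}"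
    using infinite_countable_subset by blast
  then have tnz: "c * t i + d \<noteq> 0" for i by auto
  define \<tau> where "\<tau> j = (a * t j + b) / (c * t j + d)" for j
  define D where "D = (\<Prod>j<n. (c * t j + d) ^ (n - 1))"
  have "Matrix.mat n n (\<lambda>(i, j). poly (F i) (t j)) =
      Matrix.mat n n (\<lambda>(i, j). poly (G i) (\<tau> j)) *
      Matrix.mat n n (\<lambda>(i, j). if i = j then (c * t j + d) ^ (n - 1) else 0)"
    by (rule eq_matI) (auto simp: scalar_prod_def FG tnz \<tau>_def if_distrib sum.delta cong: if_cong)
  moreover have "Determinant.det (Matrix.mat n n (\<lambda>(i, j). if i = j then (c * t j + d) ^ (n - 1) else 0)) = D"
    by (subst det_lower_triangular[of n]) (auto simp: prod_list_diag_prod D_def lessThan_atLeast0)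
  ultimately have "Determinant.det (Matrix.mat n n (\<lambda>(i, j). poly (F i) (t j))) =
      Determinant.det (Matrix.mat n n (\<lambda>(i, j). poly (G i) (\<tau> j))) * D"
    by (simp add: det_mult[of _ n])
  then have "Determinant.det (coeff_mat n F) * Determinant.det (vandermonde n t) =
      Determinant.det (coeff_mat n G) * (Determinant.det (vandermonde n \<tau>) * D)"
    using degF degG by (simp add: det_poly_values mult.assoc)
  also have "Determinant.det (vandermonde n \<tau>) * D =
      (a * d - b * c) ^ (n choose 2) * Determinant.det (vandermonde n t)"
    unfolding \<tau>_def D_def by (rule det_vandermonde_moebius) (rule tnz)
  finally show ?thesis
    using t(1) by (simp add: det_vandermonde inj_eq)
qed

lemma det_scale_rows_cols:
  fixes A :: "nat \<Rightarrow> nat \<Rightarrow> 'a::comm_ring_1"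
  shows "Determinant.det (Matrix.mat n n (\<lambda>(i, j). r i * s j * A i j)) =
    (\<Prod>i<n. r i) * (\<Prod>j<n. s j) * Determinant.det (Matrix.mat n n (\<lambda>(i, j). A i j))"
proof -
  have "(\<Prod>i = 0..<n. r i * s (p i) * A i (p i)) =
      (\<Prod>i<n. r i) * (\<Prod>j<n. s j) * (\<Prod>i = 0..<n. A i (p i))" if "p permutes {0..<n}" for p
    using prod.permute[OF that, of s] by (simp add: prod.distrib lessThan_atLeast0 comp_def)
  then show ?thesis
    by (auto simp: Determinant.det_def sum_distrib_left permutes_nat_less mult_ac intro!: sum.cong)
qed

text \<open>The matrix is a permuted discrete Fourier matrix, hence \<open>sqrt n\<close> times a unitary one: its
  rows are orthogonal by the geometric sum.\<close>

lemma cmod_det_vandermonde_roots_of_unity: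
  fixes \<zeta> :: "nat \<Rightarrow> complex"
  assumes root: "\<And>i. i < n \<Longrightarrow> \<zeta> i ^ n = 1" and inj: "inj_on \<zeta> {..<n}"
  shows "cmod (Determinant.det (vandermonde n \<zeta>)) = sqrt (real n ^ n)"
proof -
  let ?V = "vandermonde n \<zeta>"
  interpret comm_ring_hom cnj
    by unfold_locales auto
  have unit: "\<zeta> i * cnj (\<zeta> i) = 1" if "i < n" for i
  proof -
    have "cmod (\<zeta> i) = 1"
      using root[OF that] that power_eq_imp_eq_base[of "cmod (\<zeta> i)" n 1]
      by (simp flip: norm_power)
    then show ?thesis by (simp flip: complex_norm_square of_real_power)
  qed
  have orth: "(\<Sum>l<n. \<zeta> i ^ l * cnj (\<zeta> j) ^ l) = (if i = j then of_nat n else 0)"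
    if "i < n" "j < n" for i j
  proof (cases "i = j")
    case True
    then show ?thesis using unit[OF that(1)] by (simp add: power_mult_distrib[symmetric])
  next
    case False
    have "\<zeta> i * cnj (\<zeta> j) \<noteq> 1"
    proof
      assume "\<zeta> i * cnj (\<zeta> j) = 1"
      then have "\<zeta> i = \<zeta> j" using unit[OF that(2)] by (metis mult.commute mult.assoc mult_1)
      with False that inj show False by (auto dest: inj_onD)
    qed
    moreover have "(\<zeta> i * cnj (\<zeta> j)) ^ n = 1"
      using root that by (simp add: power_mult_distrib flip: complex_cnj_power)
    ultimately show ?thesis
      using False by (simp add: power_mult_distrib[symmetric] geometric_sum)
  qed
  have "?V * transpose_mat (map_mat cnj ?V) = of_nat n \<cdot>\<^sub>m 1\<^sub>m n"
    by (rule eq_matI) (auto simp: vandermonde_def scalar_prod_def orth simp flip: lessThan_atLeast0)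
  then have "Determinant.det (?V * transpose_mat (map_mat cnj ?V)) = of_nat n ^ n"
    by simp
  moreover have "?V \<in> carrier_mat n n" by (simp add: vandermonde_def)
  ultimately have "Determinant.det ?V * cnj (Determinant.det ?V) = of_nat n ^ n"
    by (simp add: det_mult[of _ n] det_transpose[of _ n])
  then have "of_real ((cmod (Determinant.det ?V))\<^sup>2) = (of_real (real n ^ n) :: complex)"
    by (simp only: complex_norm_square) simp
  then have "(cmod (Determinant.det ?V))\<^sup>2 = real n ^ n"
    by (simp only: of_real_eq_iff)
  then show ?thesis
    by (metis norm_ge_zero real_sqrt_unique)
qed

section \<open>The coefficients of the Gaussian polynomial\<close>

text \<open>By the \<open>q\<close>-binomial theorem its coefficient \<open>k\<close> is \<open>q ^ (k * (k + 1) div 2)\<close> times the Gaussian binomial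
  coefficient \<open>n - 1\<close> over \<open>k\<close>.\<close>

definition gauss_poly :: "nat \<Rightarrow> complex \<Rightarrow> complex poly" where
  "gauss_poly n q = (\<Prod>m\<in>{1..<n}. [:1, q ^ m:])"

lemma coeff_0_gauss_poly: "coeff (gauss_poly n q) 0 = 1"
  by (simp add: gauss_poly_def poly_prod flip: poly_0_coeff_0)

lemma degree_gauss_poly:
  assumes "n > 0" shows "degree (gauss_poly n q) < n"
proof -
  have "degree (gauss_poly n q) \<le> sum (degree \<circ> (\<lambda>m. [:1, q ^ m:])) {1..<n}"
    unfolding gauss_poly_def by (rule degree_prod_sum_le) simp
  also have "\<dots> \<le> (\<Sum>m\<in>{1..<n}. 1)" by (rule sum_mono) auto
  finally show ?thesis using assms by simp
qed

text \<open>Replacing \<open>T\<close> by \<open>q T\<close> shifts the range of the factors by one. Comparing coefficients turns this into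
  the two-term recursion for Gaussian binomials.\<close>

lemma gauss_poly_functional_equation:
  assumes "n > 0"
  shows "[:1, q:] * pcompose (gauss_poly n q) [:0, q:] = [:1, q ^ n:] * gauss_poly n q"
proof -
  have "[:1, q:] * pcompose (gauss_poly n q) [:0, q:] = [:1, q ^ 1:] * (\<Prod>m\<in>{1..<n}. [:1, q ^ Suc m:])"
    by (simp add: gauss_poly_def pcompose_prod pcompose_pCons mult.commute)
  also have "\<dots> = (\<Prod>m\<in>{1..<Suc n}. [:1, q ^ m:])"
    using assms prod.atLeast_Suc_lessThan[of 1 "Suc n" "\<lambda>m. [:1, q ^ m:]"]
      prod.shift_bounds_Suc_ivl[of "\<lambda>m. [:1, q ^ m:]" 1 n] by simp
  also have "\<dots> = [:1, q ^ n:] * gauss_poly n q"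
    using assms by (simp add: gauss_poly_def prod.atLeastLessThan_Suc mult.commute)
  finally show ?thesis .
qed

lemma coeff_gauss_poly_Suc:
  assumes "n > 0"
  shows "coeff (gauss_poly n q) (Suc k) * (1 - q ^ Suc k) = coeff (gauss_poly n q) k * (q ^ Suc k - q ^ n)"
proof -
  have "coeff ([:1, q:] * pcompose (gauss_poly n q) [:0, q:]) (Suc k) = coeff ([:1, q ^ n:] * gauss_poly n q) (Suc k)"
    using gauss_poly_functional_equation[OF assms, of q] by simp
  then have "q ^ Suc k * coeff (gauss_poly n q) (Suc k) + q * (q ^ k * coeff (gauss_poly n q) k) =
      coeff (gauss_poly n q) (Suc k) + q ^ n * coeff (gauss_poly n q) k"
    by (simp add: coeff_pcompose_linear)
  moreover have "c' * (1 - q * Q) - c * (q * Q - R) = c' + R * c - (q * Q * c' + q * (Q * c))"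
    for c c' Q R
    by (simp add: algebra_simps)
  ultimately show ?thesis
    by (metis power_Suc right_minus_eq)
qed

lemma cmod_1_minus_cis: "cmod (1 - cis \<phi>) = 2 * \<bar>sin (\<phi> / 2)\<bar>"
proof -
  have "1 - cis \<phi> = cis (\<phi> / 2) * (cis (- (\<phi> / 2)) - cis (\<phi> / 2))"
    by (simp add: algebra_simps cis_mult)
  also have "cis (- (\<phi> / 2)) - cis (\<phi> / 2) = - 2 * \<i> * sin (\<phi> / 2)"
    by (simp add: complex_eq_iff)
  finally show ?thesis by (simp add: norm_mult)
qed

text \<open>The recursion multiplies the modulus by \<open>\<bar>q ^ m - q ^ n\<bar> / \<bar>1 - q ^ m\<bar>\<close> at step \<open>m\<close>. Since \<open>q ^ n = - 1\<close>,
  numerator and denominator are twice the cosine and the sine of half the argument of \<open>q ^ m\<close>.\<close>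

lemma cmod_coeff_gauss_poly:
  assumes "k < n"
  shows "cmod (coeff (gauss_poly n (cis (pi / real n))) k) = (\<Prod>m\<in>{1..k}. cot (pi * real m / (2 * real n)))"
  using assms
proof (induction k)
  case (Suc k)
  define \<phi> where "\<phi> = pi * real (Suc k) / (2 * real n)"
  let ?q = "cis (pi / real n)" and ?c = "coeff (gauss_poly n (cis (pi / real n)))"
  have "0 < \<phi>" "\<phi> < pi / 2"
    using Suc.prems by (simp_all add: \<phi>_def field_simps del: of_nat_Suc)
  then have pos: "sin \<phi> > 0" "cos \<phi> > 0"
    by (auto intro: sin_gt_zero cos_gt_zero_pi)
  have qk: "?q ^ Suc k = cis (2 * \<phi>)"
  proof -
    have "real (Suc k) * (pi / real n) = 2 * \<phi>" by (simp add: \<phi>_def)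
    then show ?thesis by (simp only: Complex.DeMoivre)
  qed
  have "?q ^ n = -1"
    using Suc.prems by (simp add: Complex.DeMoivre)
  then have "?q ^ Suc k - ?q ^ n = 1 - cis (2 * \<phi> + pi)"
    unfolding qk by (simp flip: cis_mult)
  then have "cmod (?q ^ Suc k - ?q ^ n) = 2 * \<bar>sin (\<phi> + pi / 2)\<bar>"
    by (simp add: cmod_1_minus_cis add_divide_distrib)
  then have num: "cmod (?q ^ Suc k - ?q ^ n) = 2 * cos \<phi>"
    using pos by (simp add: sin_add)
  have den: "cmod (1 - ?q ^ Suc k) = 2 * sin \<phi>"
    unfolding qk using pos by (simp add: cmod_1_minus_cis)
  have "cmod (?c (Suc k)) * cmod (1 - ?q ^ Suc k) = cmod (?c k) * cmod (?q ^ Suc k - ?q ^ n)"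
    unfolding norm_mult[symmetric] using Suc.prems by (subst coeff_gauss_poly_Suc) auto
  then have "cmod (?c (Suc k)) = cmod (?c k) * cot \<phi>"
    unfolding num den using pos by (simp add: cot_def field_simps)
  then show ?case
    using Suc by (simp add: \<phi>_def del: of_nat_Suc)
qed (simp add: coeff_0_gauss_poly)

lemma prod_prefix_products:
  fixes c :: "nat \<Rightarrow> 'a::comm_monoid_mult"
  shows "(\<Prod>j<n. \<Prod>m\<in>{1..j}. c m) = (\<Prod>m\<in>{1..<n}. c m ^ (n - m))"
proof (induction n)
  case (Suc n)
  have "(\<Prod>m\<in>{1..<Suc n}. c m ^ (Suc n - m)) = (\<Prod>m\<in>{1..n}. c m * c m ^ (n - m))"
    by (rule prod.cong) (auto simp: Suc_diff_le)
  also have "\<dots> = (\<Prod>m\<in>{1..n}. c m) * (\<Prod>m\<in>{1..n}. c m ^ (n - m))"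
    by (rule prod.distrib)
  also have "(\<Prod>m\<in>{1..n}. c m ^ (n - m)) = (\<Prod>m\<in>{1..<n}. c m ^ (n - m))"
    by (rule prod.mono_neutral_right) auto
  finally show ?case using Suc by (simp add: mult.commute)
qed simp

text \<open>The factor with index \<open>n - k\<close> contributes \<open>c k\<close> with exponent \<open>- k\<close>, which leaves \<open>(n - k) - k\<close>. For even \<open>n\<close>
  the middle factor is its own partner and equals 1.\<close>

lemma prod_reciprocal_pairs:
  fixes c :: "nat \<Rightarrow> real"
  assumes pos: "\<And>m. 1 \<le> m \<Longrightarrow> m < n \<Longrightarrow> c m > 0"
    and recip: "\<And>m. 1 \<le> m \<Longrightarrow> m < n \<Longrightarrow> c m * c (n - m) = 1"
  shows "(\<Prod>m\<in>{1..<n}. c m ^ (n - m)) = (\<Prod>k\<in>{1..n div 2}. c k ^ (n - 2 * k))"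
proof (cases "n \<ge> 2")
  case True
  let ?L = "{1..n div 2}" and ?U = "{n div 2 <..< n}"
  have "(\<Prod>m\<in>?U. c m ^ (n - m)) = (\<Prod>k\<in>{1..<n - n div 2}. c (n - k) ^ k)"
    by (rule prod.reindex_bij_witness[of _ "\<lambda>k. n - k" "\<lambda>k. n - k"]) auto
  also have "\<dots> = (\<Prod>k\<in>?L. c (n - k) ^ k)"
  proof (rule prod.mono_neutral_left)
    show "\<forall>i\<in>?L - {1..<n - n div 2}. c (n - i) ^ i = 1"
    proof
      fix i assume i: "i \<in> ?L - {1..<n - n div 2}"
      then have "n - i = i" "1 \<le> i" "i < n" by auto
      with recip[of i] pos[of i] have "c i = 1"
        by (auto simp: square_eq_1_iff)
      with \<open>n - i = i\<close> show "c (n - i) ^ i = 1" by simp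
    qed
  qed auto
  finally have U: "(\<Prod>m\<in>?U. c m ^ (n - m)) = (\<Prod>k\<in>?L. c (n - k) ^ k)" .
  have "(\<Prod>m\<in>{1..<n}. c m ^ (n - m)) = (\<Prod>m\<in>?L \<union> ?U. c m ^ (n - m))"
    using True by (intro prod.cong) auto
  also have "\<dots> = (\<Prod>m\<in>?L. c m ^ (n - m)) * (\<Prod>m\<in>?U. c m ^ (n - m))"
    by (rule prod.union_disjoint) auto
  also have "\<dots> = (\<Prod>k\<in>?L. c k ^ (n - 2 * k))"
    unfolding U prod.distrib[symmetric]
  proof (rule prod.cong)
    fix k assume k: "k \<in> ?L"
    then have "n - k = (n - 2 * k) + k" "1 \<le> k" "k < n" using True by auto
    then have "c k ^ (n - k) = c k ^ (n - 2 * k) * c k ^ k"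
      by (metis power_add)
    moreover have "c k ^ k * c (n - k) ^ k = 1"
      unfolding power_mult_distrib[symmetric] using recip[of k] \<open>1 \<le> k\<close> \<open>k < n\<close> by simp
    ultimately show "c k ^ (n - k) * c (n - k) ^ k = c k ^ (n - 2 * k)" by simp
  qed simp
  finally show ?thesis .
next
  case False
  then have "n = 0 \<or> n = 1" by auto
  then show ?thesis by auto
qed

lemma prod_cmod_coeff_gauss_poly:
  "(\<Prod>j<n. cmod (coeff (gauss_poly n (cis (pi / real n))) j)) =
    (\<Prod>k\<in>{1..n div 2}. cot (pi * real k / (2 * real n)) ^ (n - 2 * k))"
proof -
  have "(\<Prod>j<n. cmod (coeff (gauss_poly n (cis (pi / real n))) j)) =
      (\<Prod>j<n. \<Prod>m\<in>{1..j}. cot (pi * real m / (2 * real n)))"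
    by (rule prod.cong) (auto simp: cmod_coeff_gauss_poly)
  also have "\<dots> = (\<Prod>k\<in>{1..n div 2}. cot (pi * real k / (2 * real n)) ^ (n - 2 * k))"
    unfolding prod_prefix_products
  proof (rule prod_reciprocal_pairs)
    fix m :: nat assume m: "1 \<le> m" "m < n"
    define \<phi> where "\<phi> = pi * real m / (2 * real n)"
    have "0 < \<phi>" "\<phi> < pi / 2"
      using m by (simp_all add: \<phi>_def field_simps)
    then have pos: "sin \<phi> > 0" "cos \<phi> > 0"
      by (auto intro: sin_gt_zero cos_gt_zero_pi)
    show "cot (pi * real m / (2 * real n)) > 0"
      unfolding \<phi>_def[symmetric] using pos by (simp add: cot_def)
    have "pi * real (n - m) / (2 * real n) = pi / 2 - \<phi>"
      using m by (simp add: \<phi>_def of_nat_diff field_simps)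
    then show "cot (pi * real m / (2 * real n)) * cot (pi * real (n - m) / (2 * real n)) = 1"
      unfolding \<phi>_def[symmetric] using m pos by (simp add: cot_def sin_diff cos_diff of_nat_diff)
  qed
  finally show ?thesis .
qed

(* the dollar sign also denotes the entries of the vectors that matrices act on; here only points of space have components *)
no_notation vec_index (infixl "$" 100)

section \<open>Directions in space as unit vectors of two complex coordinates\<close>

text \<open>The inverse image of the direction \<open>d\<close> under the Hopf map. It contains the ratio condition of
  \<^const>\<open>atiyah_choice\<close> in a form without division, so that the pole of the stereographic projection is no
  special case.\<close>

definition spinor :: "complex \<Rightarrow> complex \<Rightarrow> real^3 \<Rightarrow> bool" where
  "spinor z w d \<longleftrightarrow> z * cnj z + w * cnj w = 1 \<and> 2 * (z * cnj w) = Complex (d $ 1) (d $ 2) \<and>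
     z * cnj z - w * cnj w = of_real (d $ 3)"

text \<open>This is why the convention for \<open>i > j\<close> in \<^const>\<open>atiyah_choice\<close> is consistent with reversing the edge.\<close>

lemma spinor_uminus: "spinor z w d \<Longrightarrow> spinor (- cnj w) (cnj z) (- d)"
  by (auto simp: spinor_def algebra_simps complex_eq_iff)

lemma sum_and_difference_determine:
  fixes a b :: complex
  assumes "a + b = a' + b'" "a - b = a' - b'"
  shows "a = a'" "b = b'"
  using assms by (auto simp: complex_eq_iff)

text \<open>The phase is the Hermitian inner product of the two spinors.\<close>

lemma spinor_unique_up_to_phase:
  assumes "spinor z w d" "spinor z' w' d"
  obtains \<rho> where "cmod \<rho> = 1" "z = \<rho> * z'" "w = \<rho> * w'"
proof
  define \<rho> where "\<rho> = z * cnj z' + w * cnj w'"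
  have 1: "z * cnj z + w * cnj w = 1" "z' * cnj z' + w' * cnj w' = 1"
    and "2 * (z * cnj w) = 2 * (z' * cnj w')"
    and diff: "z * cnj z - w * cnj w = z' * cnj z' - w' * cnj w'"
    using assms by (auto simp: spinor_def)
  then have zw: "z * cnj w = z' * cnj w'" by simp
  from 1 diff have zz: "z * cnj z = z' * cnj z'" and ww: "w * cnj w = w' * cnj w'"
    by (metis sum_and_difference_determine)+
  have wz: "w * cnj z = w' * cnj z'"
    using arg_cong[OF zw, of cnj] by (simp add: mult.commute)
  have "\<rho> * z' = z * (z' * cnj z') + w * (z' * cnj w')"
    by (simp add: \<rho>_def algebra_simps)
  also have "\<dots> = z * (z * cnj z + w * cnj w)"
    unfolding zz[symmetric] zw[symmetric] by (simp add: algebra_simps)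
  finally show z: "z = \<rho> * z'" by (simp add: 1)
  have "\<rho> * w' = z * (w' * cnj z') + w * (w' * cnj w')"
    by (simp add: \<rho>_def algebra_simps)
  also have "\<dots> = w * (z * cnj z + w * cnj w)"
    unfolding ww[symmetric] wz[symmetric] by (simp add: algebra_simps)
  finally show w: "w = \<rho> * w'" by (simp add: 1)
  have "\<rho> * cnj \<rho> * (z' * cnj z' + w' * cnj w') = z * cnj z + w * cnj w"
    unfolding z w by (simp add: algebra_simps)
  then have "complex_of_real ((cmod \<rho>)\<^sup>2) = 1"
    unfolding complex_norm_square by (simp add: 1)
  then have "(cmod \<rho>)\<^sup>2 = 1" by (simp only: of_real_eq_1_iff)
  then show "cmod \<rho> = 1" by (simp add: power2_eq_1_iff) (smt (verit) norm_ge_zero)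
qed

lemma spinor_phase:
  assumes "spinor (\<rho> * z) (\<rho> * w) d" "cmod \<rho> = 1"
  shows "spinor z w d"
proof -
  have \<rho>: "\<rho> * cnj \<rho> = 1" using assms(2) by (simp flip: complex_norm_square)
  have "(\<rho> * a) * cnj (\<rho> * b) = a * cnj b" for a b
  proof -
    have "(\<rho> * a) * cnj (\<rho> * b) = (\<rho> * cnj \<rho>) * (a * cnj b)" by (simp add: mult_ac)
    then show ?thesis by (simp add: \<rho>)
  qed
  then show ?thesis using assms(1) by (simp only: spinor_def)
qed

lemma norm_vec3_eq_sqrt: "norm (d :: real^3) = sqrt (\<Sum>k\<in>UNIV. (d $ k)\<^sup>2)"
  by (simp add: norm_vec_def L2_set_def)

text \<open>By the stereographic formula \<open>z / w\<close> has square modulus \<open>(N + v3) / (N - v3)\<close>, where \<open>N\<close> is the length of the edge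
  and \<open>v3\<close> its third component; with the normalisation this determines both moduli.\<close>

lemma atiyah_choice_spinor_less:
  assumes "atiyah_choice n x z w" "i \<in> {1..n}" "j \<in> {1..n}" "i < j" "x i \<noteq> x j"
  shows "spinor (z i j) (w i j) ((x j - x i) /\<^sub>R norm (x j - x i))"
proof -
  define v where "v = x j - x i"
  define N where "N = norm v"
  define Z W where "Z = z i j" and "W = w i j"
  have N: "N > 0" using assms(5) by (simp add: N_def v_def)
  have N2: "N\<^sup>2 = (v $ 1)\<^sup>2 + (v $ 2)\<^sup>2 + (v $ 3)\<^sup>2"
    by (simp add: N_def norm_vec3_eq_sqrt sum_3 sum_nonneg)
  have unit: "(cmod Z)\<^sup>2 + (cmod W)\<^sup>2 = 1"
    and ratio: "if N - v $ 3 = 0 then W = 0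
       else W \<noteq> 0 \<and> Z / W = Complex (v $ 1) (v $ 2) / complex_of_real (N - v $ 3)"
    using assms by (auto simp: atiyah_choice_def Let_def Z_def W_def N_def v_def norm_vec3_eq_sqrt split: if_splits)
  have zz: "Z * cnj Z = of_real ((cmod Z)\<^sup>2)" and ww: "W * cnj W = of_real ((cmod W)\<^sup>2)"
    by (simp_all only: complex_norm_square)
  have "2 * (Z * cnj W) = Complex (v $ 1 / N) (v $ 2 / N) \<and> (cmod Z)\<^sup>2 - (cmod W)\<^sup>2 = v $ 3 / N"
  proof (cases "N = v $ 3")
    case True
    then have "(v $ 1)\<^sup>2 + (v $ 2)\<^sup>2 = 0" using N2 by simp
    then have "v $ 1 = 0" "v $ 2 = 0" by (simp_all add: sum_power2_eq_zero_iff)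
    moreover have "W = 0" using True ratio by simp
    moreover from this have "(cmod Z)\<^sup>2 = 1" using unit by simp
    ultimately show ?thesis using True N by (simp add: Complex_eq_0)
  next
    case False
    define D where "D = N - v $ 3"
    have D: "D \<noteq> 0" using False by (simp add: D_def)
    define q where "q = Complex (v $ 1) (v $ 2) / complex_of_real D"
    have Z: "Z = q * W" and W: "W \<noteq> 0" using ratio False by (auto simp: q_def D_def field_simps)
    have q2: "(cmod q)\<^sup>2 = (N + v $ 3) / D"
    proof -
      have "(cmod q)\<^sup>2 = ((v $ 1)\<^sup>2 + (v $ 2)\<^sup>2) / D\<^sup>2"
        by (simp add: q_def norm_divide power_divide cmod_def add_divide_distrib)
      also have "(v $ 1)\<^sup>2 + (v $ 2)\<^sup>2 = (N + v $ 3) * D"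
        using N2 by (simp add: D_def power2_eq_square algebra_simps)
      finally show ?thesis using D by (simp add: power2_eq_square)
    qed
    have "((cmod q)\<^sup>2 + 1) * (cmod W)\<^sup>2 = 1"
      using unit by (simp add: Z norm_mult power_mult_distrib algebra_simps)
    moreover have "(cmod q)\<^sup>2 + 1 = 2 * N / D"
      using D by (simp add: q2 field_simps) (simp add: D_def)
    ultimately have "2 * N / D * (cmod W)\<^sup>2 = 1" by (simp only:)
    then have W2: "(cmod W)\<^sup>2 = D / (2 * N)"
      using N D by (simp add: field_simps)
    have "2 * (Z * cnj W) = 2 * q * of_real ((cmod W)\<^sup>2)"
      by (simp only: Z mult.assoc ww)
    also have "\<dots> = Complex (v $ 1 / N) (v $ 2 / N)"
      using N D by (simp add: W2 q_def complex_eq_iff)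
    finally have "2 * (Z * cnj W) = Complex (v $ 1 / N) (v $ 2 / N)" .
    moreover have "(cmod Z)\<^sup>2 - (cmod W)\<^sup>2 = v $ 3 / N"
    proof -
      have "(cmod Z)\<^sup>2 - (cmod W)\<^sup>2 = 1 - 2 * (cmod W)\<^sup>2" using unit by simp
      also have "\<dots> = v $ 3 / N" using N by (simp add: W2 D_def field_simps)
      finally show ?thesis .
    qed
    ultimately show ?thesis by simp
  qed
  then show ?thesis
    unfolding spinor_def Z_def[symmetric] W_def[symmetric] v_def[symmetric] N_def[symmetric] zz ww
      of_real_add[symmetric] of_real_diff[symmetric]
    by (auto simp: unit divide_inverse_commute simp del: of_real_add of_real_diff of_real_power)
qed

lemma atiyah_choice_spinor:
  assumes "atiyah_choice n x z w" "i \<in> {1..n}" "j \<in> {1..n}" "x i \<noteq> x j"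
  shows "spinor (z i j) (w i j) ((x j - x i) /\<^sub>R norm (x j - x i))"
proof -
  consider "i < j" | "j < i" using assms(4) by (metis nat_neq_iff)
  then show ?thesis
  proof cases
    case 2
    have "z i j = - cnj (w j i)" "w i j = cnj (z j i)"
      using assms 2 by (auto simp: atiyah_choice_def)
    moreover have "(x j - x i) /\<^sub>R norm (x j - x i) = - ((x i - x j) /\<^sub>R norm (x i - x j))"
      by (simp add: norm_minus_commute scaleR_diff_right)
    ultimately show ?thesis
      using spinor_uminus[OF atiyah_choice_spinor_less[OF assms(1,3,2) 2]] assms(4) by simp
  qed (use assms in \<open>blast intro: atiyah_choice_spinor_less\<close>)
qed

text \<open>A choice for the two points \<open>0\<close> and \<open>d\<close> is a spinor of \<open>d\<close>.\<close>

lemma spinor_exists: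
  assumes "norm d = 1"
  obtains z w where "spinor z w d"
proof -
  define x :: "nat \<Rightarrow> real^3" where "x i = (if i = 1 then 0 else d)" for i
  obtain z w where "atiyah_choice 2 x z w" using atiyah_choice_exists by blast
  then have "spinor (z 1 2) (w 1 2) ((x 2 - x 1) /\<^sub>R norm (x 2 - x 1))"
    by (rule atiyah_choice_spinor) (use assms in \<open>auto simp: x_def\<close>)
  then show thesis using assms that by (simp add: x_def)
qed

text \<open>The angle between two directions is read off from the components of one spinor along the other and along
  its antipode.\<close>

lemma spinor_inner:
  assumes "spinor z w d" "spinor z' w' d'"
  shows "inner d d' = (cmod (z' * cnj z + w' * cnj w))\<^sup>2 - (cmod (z * w' - w * z'))\<^sup>2"
proof -
  have d: "d $ 1 = Re (2 * (z * cnj w))" "d $ 2 = Im (2 * (z * cnj w))" "d $ 3 = Re (z * cnj z - w * cnj w)"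
    and d': "d' $ 1 = Re (2 * (z' * cnj w'))" "d' $ 2 = Im (2 * (z' * cnj w'))"
      "d' $ 3 = Re (z' * cnj z' - w' * cnj w')"
    using assms by (auto simp: spinor_def)
  show ?thesis
    unfolding inner_vec_def sum_3 d d' cmod_power2 by (simp add: power2_eq_square algebra_simps)
qed

text \<open>Expand a spinor of \<open>v\<close> in the basis given by a spinor \<open>p\<close> of \<open>u\<close> and its antipode. Orthogonality makes the two
  coefficients equal in modulus, and the phase of \<open>p\<close> can be adjusted so that they also agree in phase.\<close>

lemma spinor_pair:
  assumes "norm u = 1" "norm v = 1" "inner u v = 0"
  obtains z w where "spinor z w u" "spinor ((z - cnj w) / sqrt 2) ((w + cnj z) / sqrt 2) v"
proof -
  obtain z w where p: "spinor z w u" using assms spinor_exists by blast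
  obtain z' w' where q: "spinor z' w' v" using assms spinor_exists by blast
  define A B where "A = z' * cnj z + w' * cnj w" and "B = z * w' - w * z'"
  have 1: "z * cnj z + w * cnj w = 1" "z' * cnj z' + w' * cnj w' = 1"
    using p q by (auto simp: spinor_def)
  have "A * cnj A + B * cnj B = (z * cnj z + w * cnj w) * (z' * cnj z' + w' * cnj w')"
    by (simp add: A_def B_def algebra_simps)
  then have "complex_of_real ((cmod A)\<^sup>2 + (cmod B)\<^sup>2) = 1"
    unfolding of_real_add complex_norm_square by (simp add: 1)
  then have "(cmod A)\<^sup>2 + (cmod B)\<^sup>2 = 1" by (simp only: of_real_eq_1_iff)
  moreover have "(cmod A)\<^sup>2 - (cmod B)\<^sup>2 = 0"
    using spinor_inner[OF p q] assms(3) by (simp add: A_def B_def)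
  ultimately have "(cmod A)\<^sup>2 = 1 / 2" "(cmod B)\<^sup>2 = 1 / 2" by simp_all
  then have A: "cmod A = 1 / sqrt 2" and B: "cmod B = 1 / sqrt 2"
    by (metis norm_ge_zero real_sqrt_unique real_sqrt_divide real_sqrt_one)+
  \<comment> \<open>The antipode of \<open>\<delta> p\<close> is \<open>cnj \<delta>\<close> times that of \<open>p\<close>, so the ratio of the coefficients must be \<open>\<delta>\<^sup>2\<close>.\<close>
  define \<delta> where "\<delta> = csqrt (A / B)"
  have \<delta>2: "\<delta> * \<delta> = A / B" by (simp add: \<delta>_def flip: power2_eq_square)
  have "cmod \<delta> = 1" using A B by (simp add: \<delta>_def norm_divide)
  then have \<delta>: "\<delta> * cnj \<delta> = 1" by (simp flip: complex_norm_square)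
  then have \<delta>': "cnj \<delta> * \<delta> = 1" by (simp add: mult.commute)
  have nz: "B \<noteq> 0" "\<delta> \<noteq> 0" using B \<open>cmod \<delta> = 1\<close> by auto
  define s where "s = complex_of_real (sqrt 2)"
  have s: "s * s = 2" "s \<noteq> 0" by (simp_all add: s_def flip: of_real_mult)
  define \<rho> where "\<rho> = s * (B * \<delta>)"
  have \<rho>: "cmod \<rho> = 1" using B \<open>cmod \<delta> = 1\<close> by (simp add: \<rho>_def s_def norm_mult)
  have AB: "A = B * \<delta> * \<delta>" using \<delta>2 nz by (simp add: mult.assoc)
  define a b where "a = \<delta> * z" and "b = \<delta> * w"
  have "spinor a b u"
    by (rule spinor_phase[of "cnj \<delta>"]) (use p \<open>cmod \<delta> = 1\<close> in \<open>simp_all add: a_def b_def \<delta>' flip: mult.assoc\<close>)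
  moreover have "spinor ((a - cnj b) / s) ((b + cnj a) / s) v"
  proof (rule spinor_phase[OF _ \<rho>])
    have "A * z - B * cnj w = z' * (z * cnj z + w * cnj w)"
      "A * w + B * cnj z = w' * (z * cnj z + w * cnj w)"
      by (simp_all add: A_def B_def algebra_simps)
    then have "z' = A * z - B * cnj w" "w' = A * w + B * cnj z" by (simp_all add: 1)
    moreover have "\<rho> * (y / s) = B * \<delta> * y" for y using s by (simp add: \<rho>_def)
    moreover have "B * \<delta> * (a - cnj b) = (B * \<delta> * \<delta>) * z - B * (\<delta> * cnj \<delta>) * cnj w"
      "B * \<delta> * (b + cnj a) = (B * \<delta> * \<delta>) * w + B * (\<delta> * cnj \<delta>) * cnj z"
      by (simp_all add: a_def b_def algebra_simps)
    ultimately show "spinor (\<rho> * ((a - cnj b) / s)) (\<rho> * ((b + cnj a) / s)) v"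
      using q by (simp add: \<delta> flip: AB)
  qed
  ultimately show thesis using that by (simp add: s_def)
qed

text \<open>The norm and the Hopf map, up to scale, of the vector \<open>E e1 + e2\<close> of \<open>spinor_frame\<close>, as polynomial identities.
  The letters \<open>e\<close>, \<open>x\<close>, \<open>y\<close> stand for the conjugates of \<open>E\<close>, \<open>w\<close>, \<open>z\<close>, and \<open>j\<close> for the imaginary unit.\<close>

lemma spinor_frame_identities:
  fixes E e j z w x y :: complex
  assumes "E * e = 1" "j * j = -1"
  shows "(E * (z + j * x) + (z - j * x)) * (e * (y - j * w) + (y + j * w)) +
      (E * (w - j * y) + (w + j * y)) * (e * (x + j * z) + (x - j * z)) = 4 * (z * y + w * x)"
    and "(E * (z + j * x) + (z - j * x)) * (e * (x + j * z) + (x - j * z)) =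
      (E + e) * (2 * (z * x)) - j * (E - e) * (z\<^sup>2 - x\<^sup>2)"
    and "(E * (z + j * x) + (z - j * x)) * (e * (y - j * w) + (y + j * w)) -
      (E * (w - j * y) + (w + j * y)) * (e * (x + j * z) + (x - j * z)) =
      2 * (E + e) * (z * y - w * x) - 2 * j * (E - e) * (- z * w - y * x)"
proof -
  have "(E * (z + j * x) + (z - j * x)) * (e * (y - j * w) + (y + j * w)) +
      (E * (w - j * y) + (w + j * y)) * (e * (x + j * z) + (x - j * z)) =
      ((E * e + 1) * (1 - j * j) + (E + e) * (1 + j * j)) * (z * y + w * x)"
    by (simp add: algebra_simps)
  then show "(E * (z + j * x) + (z - j * x)) * (e * (y - j * w) + (y + j * w)) +
      (E * (w - j * y) + (w + j * y)) * (e * (x + j * z) + (x - j * z)) = 4 * (z * y + w * x)"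
    by (simp add: assms)
  have "(E * (z + j * x) + (z - j * x)) * (e * (x + j * z) + (x - j * z)) =
      E * e * ((1 + j * j) * (z * x) + j * (z\<^sup>2 + x\<^sup>2)) + (E + e) * ((1 - j * j) * (z * x)) -
      j * (E - e) * (z\<^sup>2 - x\<^sup>2) + ((1 + j * j) * (z * x) - j * (z\<^sup>2 + x\<^sup>2))"
    by (simp add: algebra_simps power2_eq_square)
  then show "(E * (z + j * x) + (z - j * x)) * (e * (x + j * z) + (x - j * z)) =
      (E + e) * (2 * (z * x)) - j * (E - e) * (z\<^sup>2 - x\<^sup>2)"
    by (simp add: assms)
  have "(E * (z + j * x) + (z - j * x)) * (e * (y - j * w) + (y + j * w)) -
      (E * (w - j * y) + (w + j * y)) * (e * (x + j * z) + (x - j * z)) =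
      (E * e + 1) * (1 + j * j) * (z * y - w * x) + (E * e - 1) * (2 * j * (x * y - z * w)) +
      (E + e) * (1 - j * j) * (z * y - w * x) - 2 * j * (E - e) * (- z * w - y * x)"
    by (simp add: algebra_simps)
  then show "(E * (z + j * x) + (z - j * x)) * (e * (y - j * w) + (y + j * w)) -
      (E * (w - j * y) + (w + j * y)) * (e * (x + j * z) + (x - j * z)) =
      2 * (E + e) * (z * y - w * x) - 2 * j * (E - e) * (- z * w - y * x)"
    by (simp add: assms)
qed

text \<open>If \<open>p\<close> is the spinor of \<open>u\<close> from \<open>spinor_pair\<close> and \<open>p'\<close> its antipode, the direction at angle \<open>\<theta>\<close> has the spinor
  \<open>cos (\<theta> / 2) p + sin (\<theta> / 2) p'\<close>. Up to phase this is \<open>(E e1 + e2) / sqrt 2\<close> with \<open>E = cis \<theta>\<close>,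
  \<open>e1 = (p - \<i> p') / sqrt 2\<close> and \<open>e2 = (p + \<i> p') / sqrt 2\<close>. The vectors \<open>e1 = (a, b)\<close> and \<open>e2 = (c, d)\<close> are spinors of
  the two normals of the plane.\<close>

lemma spinor_frame:
  assumes "norm u = 1" "norm v = 1" "inner u v = 0"
  obtains a b c d where "cmod (a * d - b * c) = 1"
    "\<And>E. cmod E = 1 \<Longrightarrow> spinor ((E * a + c) / sqrt 2) ((E * b + d) / sqrt 2) (Re E *\<^sub>R u + Im E *\<^sub>R v)"
proof -
  obtain z w where u: "spinor z w u" and v: "spinor ((z - cnj w) / sqrt 2) ((w + cnj z) / sqrt 2) v"
    using spinor_pair[OF assms] by blast
  define s where "s = complex_of_real (sqrt 2)"
  have s: "s * s = 2" "s \<noteq> 0" "cnj s = s" by (simp_all add: s_def flip: of_real_mult)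
  have 1: "z * cnj z + w * cnj w = 1" using u by (simp add: spinor_def)
  have v12: "z\<^sup>2 - (cnj w)\<^sup>2 = Complex (v $ 1) (v $ 2)" and v3: "- z * w - cnj z * cnj w = of_real (v $ 3)"
  proof -
    have half: "p / s * cnj (q / s) = p * cnj q / 2" for p q
      by (simp add: s)
    have "2 * ((z - cnj w) / s * cnj ((w + cnj z) / s)) = Complex (v $ 1) (v $ 2)"
      and "(z - cnj w) / s * cnj ((z - cnj w) / s) - (w + cnj z) / s * cnj ((w + cnj z) / s) = of_real (v $ 3)"
      using v by (simp_all only: spinor_def s_def)
    then have "(z - cnj w) * cnj (w + cnj z) = Complex (v $ 1) (v $ 2)"
      and "(z - cnj w) * cnj (z - cnj w) / 2 - (w + cnj z) * cnj (w + cnj z) / 2 = of_real (v $ 3)"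
      unfolding half by simp_all
    moreover have "(z - cnj w) * cnj (w + cnj z) = z\<^sup>2 - (cnj w)\<^sup>2"
      "(z - cnj w) * cnj (z - cnj w) / 2 - (w + cnj z) * cnj (w + cnj z) / 2 = - z * w - cnj z * cnj w"
      by (simp_all add: power2_eq_square field_simps)
    ultimately show "z\<^sup>2 - (cnj w)\<^sup>2 = Complex (v $ 1) (v $ 2)" and "- z * w - cnj z * cnj w = of_real (v $ 3)"
      by simp_all
  qed
  define a b c d where "a = (z + \<i> * cnj w) / s" and "b = (w - \<i> * cnj z) / s"
    and "c = (z - \<i> * cnj w) / s" and "d = (w + \<i> * cnj z) / s"
  show thesis
  proof
    have "a * d - b * c = ((z + \<i> * cnj w) * (w + \<i> * cnj z) - (w - \<i> * cnj z) * (z - \<i> * cnj w)) / (s * s)"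
      unfolding a_def b_def c_def d_def by (simp only: times_divide_times_eq flip: diff_divide_distrib)
    also have "\<dots> = \<i> * (z * cnj z + w * cnj w)"
      unfolding s(1) by (simp add: algebra_simps)
    finally show "cmod (a * d - b * c) = 1" by (simp add: 1)
  next
    fix E assume "cmod E = 1"
    then have E: "E * cnj E = 1" by (simp flip: complex_norm_square)
    have re: "complex_of_real (Re E) = (E + cnj E) / 2" and im: "complex_of_real (Im E) = - \<i> * (E - cnj E) / 2"
      by (simp_all add: complex_eq_iff)
    define Z W where "Z = (E * a + c) / s" and "W = (E * b + d) / s"
    have Z: "2 * Z = E * (z + \<i> * cnj w) + (z - \<i> * cnj w)"
      and W: "2 * W = E * (w - \<i> * cnj z) + (w + \<i> * cnj z)"
      using s(2) unfolding s(1)[symmetric] Z_def W_def a_def b_def c_def d_def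
      by (simp_all add: field_simps)
    have cZ: "2 * cnj Z = cnj E * (cnj z - \<i> * w) + (cnj z + \<i> * w)"
      and cW: "2 * cnj W = cnj E * (cnj w + \<i> * z) + (cnj w - \<i> * z)"
      using arg_cong[OF Z, of cnj] arg_cong[OF W, of cnj] by simp_all
    have "4 * (Z * cnj Z + W * cnj W) = 2 * Z * (2 * cnj Z) + 2 * W * (2 * cnj W)"
      by simp
    also have "\<dots> = 4 * (z * cnj z + w * cnj w)"
      unfolding Z W cZ cW using spinor_frame_identities(1)[OF E, of \<i>] by simp
    finally have "Z * cnj Z + W * cnj W = 1"
      by (simp only: 1 mult_cancel_left) simp
    moreover have "2 * (Z * cnj W) = Complex ((Re E *\<^sub>R u + Im E *\<^sub>R v) $ 1) ((Re E *\<^sub>R u + Im E *\<^sub>R v) $ 2)"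
    proof -
      have "2 * (2 * (Z * cnj W)) = 2 * Z * (2 * cnj W)"
        by simp
      also have "\<dots> = 2 * (Re E * (2 * (z * cnj w)) + Im E * (z\<^sup>2 - (cnj w)\<^sup>2))"
        unfolding Z cW re im by (subst spinor_frame_identities(2)[OF E]) (simp_all add: field_simps)
      also have "2 * (z * cnj w) = Complex (u $ 1) (u $ 2)"
        using u by (simp add: spinor_def)
      finally show ?thesis by (simp add: v12 complex_eq_iff)
    qed
    moreover have "Z * cnj Z - W * cnj W = of_real ((Re E *\<^sub>R u + Im E *\<^sub>R v) $ 3)"
    proof -
      have "4 * (Z * cnj Z - W * cnj W) = 2 * Z * (2 * cnj Z) - 2 * W * (2 * cnj W)"
        by simp
      also have "\<dots> = 4 * (Re E * (z * cnj z - w * cnj w) + Im E * (- z * w - cnj z * cnj w))"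
        unfolding Z W cZ cW re im by (subst spinor_frame_identities(3)[OF E]) (simp_all add: field_simps)
      also have "z * cnj z - w * cnj w = of_real (u $ 3)"
        using u by (simp add: spinor_def)
      finally show ?thesis by (simp only: v3 mult_cancel_left) simp
    qed
    ultimately show "spinor ((E * a + c) / sqrt 2) ((E * b + d) / sqrt 2) (Re E *\<^sub>R u + Im E *\<^sub>R v)"
      unfolding spinor_def Z_def W_def s_def by simp
  qed
qed

section \<open>Directions between the vertices of a regular polygon\<close>

text \<open>The chord is \<open>q ^ (2 * k) * q ^ m * (q ^ m - q ^ (- m))\<close>, and the last factor is \<open>2 * \<i>\<close> times the positive
  number \<open>sin (pi * m / n)\<close>.\<close>

lemma sgn_root_difference:
  fixes n k m :: nat
  assumes "0 < m" "m < n" and q: "q = cis (pi / real n)"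
  shows "sgn (q ^ (2 * (k + m)) - q ^ (2 * k)) = \<i> * q ^ (2 * k) * q ^ m"
proof -
  define s where "s = 2 * sin (pi * real m / real n)"
  have s: "s > 0"
    using assms by (auto simp: s_def field_simps intro!: sin_gt_zero)
  have qm: "q ^ m = cis (pi * real m / real n)"
    by (simp add: q Complex.DeMoivre mult.commute)
  have "q ^ (2 * (k + m)) - q ^ (2 * k) = q ^ (2 * k) * (q ^ m * q ^ m - 1)"
    by (simp add: power_add power_mult power2_eq_square algebra_simps power_mult_distrib)
  also have "q ^ m * q ^ m - 1 = q ^ m * (q ^ m - cis (- (pi * real m / real n)))"
    unfolding qm by (simp add: algebra_simps cis_mult)
  also have "q ^ m - cis (- (pi * real m / real n)) = \<i> * s"
    unfolding qm s_def by (simp add: complex_eq_iff)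
  finally have "q ^ (2 * (k + m)) - q ^ (2 * k) = s *\<^sub>R (\<i> * q ^ (2 * k) * q ^ m)"
    by (simp add: scaleR_conv_of_real mult_ac)
  moreover have "cmod (\<i> * q ^ (2 * k) * q ^ m) = 1"
    by (simp add: q norm_mult norm_power)
  ultimately show ?thesis
    using s by (simp add: sgn_scaleR sgn_div_norm)
qed

text \<open>Going once around the polygon from vertex \<open>k\<close>, the other vertices are \<open>k + m\<close> modulo \<open>n\<close>. Measuring \<open>m\<close>
  cyclically absorbs the sign that distinguishes \<open>l < k\<close> from \<open>l > k\<close>.\<close>

lemma prod_root_differences:
  fixes g :: "complex \<Rightarrow> 'a::comm_monoid_mult"
  assumes k: "k \<in> {1..n}" and q: "q = cis (pi / real n)"
  shows "(\<Prod>l\<in>{1..n} - {k}. g (sgn (q ^ (2 * l) - q ^ (2 * k)))) = (\<Prod>m\<in>{1..<n}. g (\<i> * q ^ (2 * k) * q ^ m))"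
proof (rule prod.reindex_bij_witness[of _ "\<lambda>m. if k + m \<le> n then k + m else k + m - n"
      "\<lambda>l. if k < l then l - k else l + n - k"])
  fix l assume l: "l \<in> {1..n} - {k}"
  define m where "m = (if k < l then l - k else l + n - k)"
  have m: "0 < m" "m < n" using l k by (auto simp: m_def)
  have "n > 0" using k by simp
  then have "q ^ (2 * n) = 1"
    by (simp add: q Complex.DeMoivre)
  moreover have "k + m = (if k < l then l else l + n)"
    using l k by (auto simp: m_def)
  ultimately have "q ^ (2 * (k + m)) = q ^ (2 * l)"
    by (simp add: distrib_left power_add)
  with sgn_root_difference[OF m q, of k]
  show "g (\<i> * q ^ (2 * k) * q ^ (if k < l then l - k else l + n - k)) = g (sgn (q ^ (2 * l) - q ^ (2 * k)))"
    by (simp add: m_def)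
qed (use k in auto)

text \<open>The plane of the polygon as a copy of the complex plane: for orthonormal \<open>u\<close> and \<open>v\<close> it is
  a similarity with ratio \<open>r\<close> that takes \<open>0\<close> to \<open>c\<close>.\<close>

definition plane_point :: "real^3 \<Rightarrow> real \<Rightarrow> real^3 \<Rightarrow> real^3 \<Rightarrow> complex \<Rightarrow> real^3" where
  "plane_point c r u v \<zeta> = c + r *\<^sub>R (Re \<zeta> *\<^sub>R u + Im \<zeta> *\<^sub>R v)"

lemma norm_orthonormal_combination:
  assumes "norm u = 1" "norm v = 1" "inner u v = 0"
  shows "norm (Re \<zeta> *\<^sub>R u + Im \<zeta> *\<^sub>R v) = cmod \<zeta>"
proof -
  have "inner u u = 1" "inner v v = 1" "inner v u = 0"
    using assms by (simp_all add: norm_eq_1 inner_commute)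
  then show ?thesis
    using assms(3) by (simp add: norm_eq_sqrt_inner[of "_ + _"] cmod_def inner_add_left inner_add_right power2_eq_square)
qed

lemma plane_point_diff:
  "plane_point c r u v \<eta> - plane_point c r u v \<zeta> = r *\<^sub>R (Re (\<eta> - \<zeta>) *\<^sub>R u + Im (\<eta> - \<zeta>) *\<^sub>R v)"
  by (simp add: plane_point_def algebra_simps)

lemma norm_plane_point_diff:
  assumes "norm u = 1" "norm v = 1" "inner u v = 0" "r > 0"
  shows "norm (plane_point c r u v \<eta> - plane_point c r u v \<zeta>) = r * cmod (\<eta> - \<zeta>)"
  unfolding plane_point_diff norm_scaleR norm_orthonormal_combination[OF assms(1-3)]
  using assms(4) by simp

lemma plane_point_direction:
  assumes "norm u = 1" "norm v = 1" "inner u v = 0" "r > 0"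
  shows "(plane_point c r u v \<eta> - plane_point c r u v \<zeta>) /\<^sub>R
      norm (plane_point c r u v \<eta> - plane_point c r u v \<zeta>) =
    Re (sgn (\<eta> - \<zeta>)) *\<^sub>R u + Im (sgn (\<eta> - \<zeta>)) *\<^sub>R v"
proof -
  have "(r *\<^sub>R p) /\<^sub>R (r * N) = p /\<^sub>R N" for p :: "real^3" and N
    using assms(4) by simp
  then show ?thesis
    unfolding norm_plane_point_diff[OF assms] unfolding plane_point_diff
    by (simp only:) (simp add: sgn_div_norm scaleR_add_right)
qed

lemma inj_on_roots_of_unity:
  "inj_on (\<lambda>k. cis (pi / real n) ^ (2 * k)) {1..n}"
proof (rule linorder_inj_onI)
  fix k l :: nat
  assume "k \<in> {1..n}" "l \<in> {1..n}" "k < l"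
  define m where "m = l - k"
  have m: "0 < m" "m < n" "l = k + m"
    using \<open>k \<in> {1..n}\<close> \<open>l \<in> {1..n}\<close> \<open>k < l\<close> by (auto simp: m_def)
  have "cmod (sgn (cis (pi / real n) ^ (2 * l) - cis (pi / real n) ^ (2 * k))) = 1"
    unfolding m(3) sgn_root_difference[OF m(1,2) refl] by (simp add: norm_mult norm_power)
  then show "cis (pi / real n) ^ (2 * k) \<noteq> cis (pi / real n) ^ (2 * l)" by auto
qed auto

text \<open>The permutation \<open>a\<close> records the order in which the points \<open>x i\<close> run through the vertices; the plane of the
  polygon is identified with the complex numbers.\<close>

lemma regular_polygon_points:
  assumes "regular_polygon_vertices n x"
  obtains c r u v a where "norm u = 1" "norm v = 1" "inner u v = 0" "r > 0"
    "bij_betw a {1..n} {1..n}"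
    "\<And>i. i \<in> {1..n} \<Longrightarrow> x i = plane_point c r u v (cis (pi / real n) ^ (2 * a i))"
proof -
  define P where "P = (\<lambda>c r u v k. plane_point c r u v (cis (pi / real n) ^ (2 * k)))"
  have P: "P c r u v k = c + r *\<^sub>R (cos (2 * pi * real k / real n) *\<^sub>R u + sin (2 * pi * real k / real n) *\<^sub>R v)"
    for c r u v k
    by (simp add: P_def plane_point_def Complex.DeMoivre mult_ac)
  obtain c u v r where uv: "norm u = 1" "norm v = 1" "inner u v = 0" "r > 0"
    and img: "x ` {1..n} = P c r u v ` {1..n}"
    using assms unfolding regular_polygon_vertices_def P[symmetric] by blast
  have inj: "inj_on (P c r u v) {1..n}"
  proof (rule inj_onI)
    fix k l assume kl: "k \<in> {1..n}" "l \<in> {1..n}" and "P c r u v k = P c r u v l"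
    then have "r * cmod (cis (pi / real n) ^ (2 * k) - cis (pi / real n) ^ (2 * l)) = 0"
      using norm_plane_point_diff[OF uv, of c "cis (pi / real n) ^ (2 * k)" "cis (pi / real n) ^ (2 * l)"]
      by (simp add: P_def)
    then have "cis (pi / real n) ^ (2 * k) = cis (pi / real n) ^ (2 * l)"
      using uv(4) by simp
    with kl show "k = l"
      by (simp only: inj_on_eq_iff[OF inj_on_roots_of_unity])
  qed
  then have bijP: "bij_betw (P c r u v) {1..n} (x ` {1..n})"
    using img by (simp add: bij_betw_def)
  have "card (x ` {1..n}) = card {1..n}"
    using bij_betw_same_card[OF bijP] by simp
  then have "bij_betw x {1..n} (x ` {1..n})"
    by (simp add: eq_card_imp_inj_on inj_on_imp_bij_betw)
  define a where "a = inv_into {1..n} (P c r u v) \<circ> x"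
  have "bij_betw a {1..n} {1..n}"
    unfolding a_def by (rule bij_betw_trans[OF \<open>bij_betw x {1..n} (x ` {1..n})\<close> bij_betw_inv_into[OF bijP]])
  moreover have "x i = P c r u v (a i)" if "i \<in> {1..n}" for i
    unfolding a_def comp_def using that bijP by (metis bij_betw_inv_into_right imageI)
  ultimately show thesis
    using that uv unfolding P_def by blast
qed

section \<open>The rows of the Atiyah matrix of a regular polygon\<close>

text \<open>The product is homogeneous of degree \<open>card K\<close>, so setting the second variable to 1 keeps all coefficients.\<close>

lemma coeff_coeff_prod_homogeneous:
  fixes z w :: "'i \<Rightarrow> 'a::comm_ring_1"
  assumes "finite K" "l \<le> card K"
  shows "coeff (coeff (\<Prod>k\<in>K. [:[:0, - w k:], [:z k:]:]) l) (card K - l) = coeff (\<Prod>k\<in>K. [:- w k, z k:]) l"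
  using assms
proof (induction K arbitrary: l rule: finite_induct)
  case (insert k K)
  let ?P = "\<Prod>k\<in>K. [:[:0, - w k:], [:z k:]:]" and ?Q = "\<Prod>k\<in>K. [:- w k, z k:]"
  have P0: "coeff (coeff ?P m) j = 0" if "m > card K" for m j
  proof -
    have "degree ?P \<le> sum (degree \<circ> (\<lambda>k. [:[:0, - w k:], [:z k:]:])) K"
      by (rule degree_prod_sum_le) fact
    also have "\<dots> \<le> (\<Sum>k\<in>K. 1)" by (rule sum_mono) auto
    finally show ?thesis using that by (simp add: coeff_eq_0)
  qed
  have Q0: "coeff ?Q m = 0" if "m > card K" for m
  proof -
    have "degree ?Q \<le> sum (degree \<circ> (\<lambda>k. [:- w k, z k:])) K"
      by (rule degree_prod_sum_le) fact
    also have "\<dots> \<le> (\<Sum>k\<in>K. 1)" by (rule sum_mono) auto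
    finally show ?thesis using that by (simp add: coeff_eq_0)
  qed
  have left: "coeff (coeff ?P m) (card K - m) = coeff ?Q m" if "m \<le> card K" for m
    using insert.IH that .
  show ?case
  proof (cases l)
    case 0
    then show ?thesis using insert.hyps left[of 0] by simp
  next
    case (Suc m)
    then have m: "m \<le> card K" using insert by simp
    show ?thesis
    proof (cases "m = card K")
      case True
      then show ?thesis using insert.hyps left[of m] Suc P0[of "Suc m"] Q0[of "Suc m"] by simp
    next
      case False
      then have "card K - m = Suc (card K - Suc m)" using m by simp
      then show ?thesis using insert.hyps left[of m] left[of "Suc m"] Suc m False by simp
    qed
  qed
qed simp

lemma atiyah_det_eq_det_coeff_mat:
  "atiyah_det n z w =
    Determinant.det (coeff_mat n (\<lambda>i. \<Prod>k\<in>{1..n} - {Suc i}. [:- w (Suc i) k, z (Suc i) k:]))"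
proof -
  have "atiyah_coeff n z w (Suc i) (Suc j) = coeff (\<Prod>k\<in>{1..n} - {Suc i}. [:- w (Suc i) k, z (Suc i) k:]) j"
    if "i < n" "j < n" for i j
  proof -
    have "card ({1..n} - {Suc i}) = n - 1" using that by simp
    then show ?thesis
      using coeff_coeff_prod_homogeneous[of "{1..n} - {Suc i}" j "w (Suc i)" "z (Suc i)"] that
      by (simp add: atiyah_coeff_def atiyah_poly_def)
  qed
  then show ?thesis
    unfolding atiyah_det_def coeff_mat_def by (intro arg_cong[of _ _ Determinant.det] eq_matI) auto
qed

lemma poly_gauss_poly_homogenized:
  assumes "Y \<noteq> 0" "n > 0"
  shows "(\<Prod>m\<in>{1..<n}. e * q ^ m * X + Y) = Y ^ (n - 1) * poly (gauss_poly n q) (e * (X / Y))"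
proof -
  have "(\<Prod>m\<in>{1..<n}. e * q ^ m * X + Y) = (\<Prod>m\<in>{1..<n}. Y * (1 + e * (X / Y) * q ^ m))"
    using assms(1) by (intro prod.cong) (simp_all add: field_simps)
  then show ?thesis
    by (simp add: prod.distrib gauss_poly_def poly_prod)
qed

text \<open>Row \<open>i\<close> in the adapted basis: each spinor is a phase times the frame spinor of its direction, and the
  directions out of \<open>x i\<close> are those of \<open>prod_root_differences\<close>. The number \<open>R\<close> collects the phases and the
  normalising factors \<open>1 / sqrt 2\<close>.\<close>

lemma polygon_row_factorization:
  assumes choice: "atiyah_choice n x z w"
    and uv: "norm u = 1" "norm v = 1" "inner u v = 0" "r > 0"
    and a: "bij_betw a {1..n} {1..n}"
    and x: "\<And>i. i \<in> {1..n} \<Longrightarrow> x i = plane_point p r u v (cis (pi / real n) ^ (2 * a i))"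
    and frame: "\<And>E. cmod E = 1 \<Longrightarrow>
      spinor ((E * \<alpha> + \<gamma>) / sqrt 2) ((E * \<beta> + \<delta>) / sqrt 2) (Re E *\<^sub>R u + Im E *\<^sub>R v)"
    and i: "i \<in> {1..n}"
  shows "\<exists>R. cmod R = (1 / sqrt 2) ^ (n - 1) \<and> (\<forall>t. \<gamma> * t - \<delta> \<noteq> 0 \<longrightarrow>
      poly (\<Prod>k\<in>{1..n} - {i}. [:- w i k, z i k:]) t =
      (\<gamma> * t - \<delta>) ^ (n - 1) * (R * poly (gauss_poly n (cis (pi / real n)))
        (\<i> * cis (pi / real n) ^ (2 * a i) * ((\<alpha> * t - \<beta>) / (\<gamma> * t - \<delta>)))))"
proof -
  define q where "q = cis (pi / real n)"
  define E where "E k = sgn (q ^ (2 * a k) - q ^ (2 * a i))" for k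
  have "\<exists>\<rho>. cmod \<rho> = 1 \<and> z i k = \<rho> * ((E k * \<alpha> + \<gamma>) / sqrt 2) \<and> w i k = \<rho> * ((E k * \<beta> + \<delta>) / sqrt 2)"
    if k: "k \<in> {1..n} - {i}" for k
  proof -
    have "a k \<noteq> a i" "a k \<in> {1..n}" "a i \<in> {1..n}"
      using inj_on_eq_iff[OF bij_betw_imp_inj_on[OF a], of k i] bij_betwE[OF a] i k by auto
    then have ne: "q ^ (2 * a k) \<noteq> q ^ (2 * a i)"
      unfolding q_def by (simp add: inj_on_eq_iff[OF inj_on_roots_of_unity])
    then have E: "cmod (E k) = 1" by (simp add: E_def norm_sgn)
    have "norm (x k - x i) = r * cmod (q ^ (2 * a k) - q ^ (2 * a i))"
      using i k x norm_plane_point_diff[OF uv] by (simp add: q_def)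
    then have "x i \<noteq> x k" using uv(4) ne by auto
    then have "spinor (z i k) (w i k) ((x k - x i) /\<^sub>R norm (x k - x i))"
      using atiyah_choice_spinor[OF choice i, of k] k by blast
    also have "(x k - x i) /\<^sub>R norm (x k - x i) = Re (E k) *\<^sub>R u + Im (E k) *\<^sub>R v"
      using i k x plane_point_direction[OF uv] by (simp add: q_def E_def)
    finally show ?thesis
      using spinor_unique_up_to_phase[OF _ frame[OF E]] by metis
  qed
  then obtain \<rho> where \<rho>: "\<And>k. k \<in> {1..n} - {i} \<Longrightarrow> cmod (\<rho> k) = 1"
    "\<And>k. k \<in> {1..n} - {i} \<Longrightarrow> z i k = \<rho> k * ((E k * \<alpha> + \<gamma>) / sqrt 2)"
    "\<And>k. k \<in> {1..n} - {i} \<Longrightarrow> w i k = \<rho> k * ((E k * \<beta> + \<delta>) / sqrt 2)"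
    by metis
  define R where "R = (\<Prod>k\<in>{1..n} - {i}. \<rho> k / sqrt 2)"
  show ?thesis
  proof (intro exI[of _ R] conjI allI impI)
    show "cmod R = (1 / sqrt 2) ^ (n - 1)"
      using \<rho>(1) i by (simp add: R_def prod_norm[symmetric] norm_divide)
  next
    fix t
    assume nz: "\<gamma> * t - \<delta> \<noteq> 0"
    let ?X = "\<alpha> * t - \<beta>" and ?Y = "\<gamma> * t - \<delta>"
    have ai: "a i \<in> {1..n}" using bij_betwE[OF a] i by blast
    have a': "bij_betw a ({1..n} - {i}) ({1..n} - {a i})"
      by (rule bij_betw_DiffI[OF a]) (use i ai in \<open>auto simp: bij_betw_def\<close>)
    have "poly (\<Prod>k\<in>{1..n} - {i}. [:- w i k, z i k:]) t = (\<Prod>k\<in>{1..n} - {i}. z i k * t - w i k)"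
      by (simp add: poly_prod mult.commute)
    also have "\<dots> = (\<Prod>k\<in>{1..n} - {i}. \<rho> k / sqrt 2 * (E k * ?X + ?Y))"
      by (intro prod.cong refl) (simp add: \<rho>(2,3) add_divide_distrib diff_divide_distrib algebra_simps)
    also have "\<dots> = R * (\<Prod>k\<in>{1..n} - {i}. E k * ?X + ?Y)"
      unfolding R_def by (rule prod.distrib)
    also have "(\<Prod>k\<in>{1..n} - {i}. E k * ?X + ?Y) =
        (\<Prod>l\<in>{1..n} - {a i}. sgn (q ^ (2 * l) - q ^ (2 * a i)) * ?X + ?Y)"
      unfolding E_def by (rule prod.reindex_bij_betw[OF a'])
    also have "\<dots> = (\<Prod>m\<in>{1..<n}. \<i> * q ^ (2 * a i) * q ^ m * ?X + ?Y)"
      by (rule prod_root_differences[OF ai q_def])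
    also have "\<dots> = ?Y ^ (n - 1) * poly (gauss_poly n q) (\<i> * q ^ (2 * a i) * (?X / ?Y))"
      by (rule poly_gauss_poly_homogenized[OF nz]) (use i in auto)
    finally show "poly (\<Prod>k\<in>{1..n} - {i}. [:- w i k, z i k:]) t =
      (\<gamma> * t - \<delta>) ^ (n - 1) * (R * poly (gauss_poly n (cis (pi / real n)))
        (\<i> * cis (pi / real n) ^ (2 * a i) * ((\<alpha> * t - \<beta>) / (\<gamma> * t - \<delta>))))"
      by (simp add: q_def mult_ac)
  qed
qed

text \<open>Coefficient \<open>j\<close> of row \<open>i\<close> is \<open>R i * (\<i> ^ j * coeff Q j) * \<zeta> i ^ j\<close>, an entry of a Fourier matrix rescaled by a factor
  for the row and one for the column.\<close>

lemma cmod_det_gauss_rows: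
  fixes \<zeta> R :: "nat \<Rightarrow> complex" and Q :: "complex poly"
  assumes R: "\<And>i. i < n \<Longrightarrow> cmod (R i) = b"
    and root: "\<And>i. i < n \<Longrightarrow> \<zeta> i ^ n = 1" and inj: "inj_on \<zeta> {..<n}"
  shows "cmod (Determinant.det (coeff_mat n (\<lambda>i. Polynomial.smult (R i) (pcompose Q [:0, \<i> * \<zeta> i:])))) =
    b ^ n * (\<Prod>j<n. cmod (coeff Q j)) * sqrt (real n ^ n)"
proof -
  have "coeff_mat n (\<lambda>i. Polynomial.smult (R i) (pcompose Q [:0, \<i> * \<zeta> i:])) =
      Matrix.mat n n (\<lambda>(i, j). R i * (\<i> ^ j * coeff Q j) * \<zeta> i ^ j)"
    by (rule eq_matI) (auto simp: coeff_mat_def coeff_pcompose_linear power_mult_distrib mult_ac)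
  then have "Determinant.det (coeff_mat n (\<lambda>i. Polynomial.smult (R i) (pcompose Q [:0, \<i> * \<zeta> i:]))) =
      (\<Prod>i<n. R i) * (\<Prod>j<n. \<i> ^ j * coeff Q j) * Determinant.det (vandermonde n \<zeta>)"
    unfolding vandermonde_def
    using det_scale_rows_cols[of n R "\<lambda>j. \<i> ^ j * coeff Q j" "\<lambda>i j. \<zeta> i ^ j"] by simp
  then show ?thesis
    using R cmod_det_vandermonde_roots_of_unity[OF root inj]
    by (simp add: norm_mult norm_power prod_norm[symmetric])
qed

theorem theorem2p3:
  fixes n :: nat and x :: "nat \<Rightarrow> real^3" and z w :: "nat \<Rightarrow> nat \<Rightarrow> complex"
  assumes "n \<ge> 3"
    and "regular_polygon_vertices n x"
    and "atiyah_choice n x z w"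
  shows "cmod (atiyah_det n z w) =
    real n powr (real n / 2) * 2 powr (real n * (1 - real n) / 2) *
    (\<Prod>k\<in>{1..n div 2}. cot (pi * real k / (2 * real n)) ^ (n - 2 * k))"
proof -
  define q where "q = cis (pi / real n)"
  define F where "F i = (\<Prod>k\<in>{1..n} - {Suc i}. [:- w (Suc i) k, z (Suc i) k:])" for i
  have n: "n > 0" using assms(1) by simp
  obtain c r u v a where uv: "norm u = 1" "norm v = 1" "inner u v = 0" "r > 0"
    and a: "bij_betw a {1..n} {1..n}"
    and x: "\<And>i. i \<in> {1..n} \<Longrightarrow> x i = plane_point c r u v (cis (pi / real n) ^ (2 * a i))"
    using regular_polygon_points[OF assms(2)] by metis
  obtain \<alpha> \<beta> \<gamma> \<delta> where \<Delta>: "cmod (\<alpha> * \<delta> - \<beta> * \<gamma>) = 1"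
    and frame: "\<And>E. cmod E = 1 \<Longrightarrow>
      spinor ((E * \<alpha> + \<gamma>) / sqrt 2) ((E * \<beta> + \<delta>) / sqrt 2) (Re E *\<^sub>R u + Im E *\<^sub>R v)"
    using spinor_frame[OF uv(1-3)] by metis
  have "\<exists>R. cmod R = (1 / sqrt 2) ^ (n - 1) \<and> (\<forall>t. \<gamma> * t - \<delta> \<noteq> 0 \<longrightarrow>
      poly (F i) t = (\<gamma> * t - \<delta>) ^ (n - 1) *
        (R * poly (gauss_poly n q) (\<i> * q ^ (2 * a (Suc i)) * ((\<alpha> * t - \<beta>) / (\<gamma> * t - \<delta>)))))"
    if "i < n" for i
  proof -
    have "Suc i \<in> {1..n}" using that by simp
    from polygon_row_factorization[OF assms(3) uv a x frame this] show ?thesis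
      unfolding F_def q_def .
  qed
  then obtain R where R: "\<And>i. i < n \<Longrightarrow> cmod (R i) = (1 / sqrt 2) ^ (n - 1)"
    and FR: "\<And>i t. i < n \<Longrightarrow> \<gamma> * t - \<delta> \<noteq> 0 \<Longrightarrow>
      poly (F i) t = (\<gamma> * t - \<delta>) ^ (n - 1) *
        (R i * poly (gauss_poly n q) (\<i> * q ^ (2 * a (Suc i)) * ((\<alpha> * t - \<beta>) / (\<gamma> * t - \<delta>))))"
    by metis
  define G where "G i = Polynomial.smult (R i) (pcompose (gauss_poly n q) [:0, \<i> * q ^ (2 * a (Suc i)):])" for i
  \<comment> \<open>The second column of the substitution is negated because a spinor \<open>(z, w)\<close> enters through the factor \<open>z t - w\<close>.\<close>
  have "\<alpha> * (- \<delta>) - (- \<beta>) * \<gamma> = - (\<alpha> * \<delta> - \<beta> * \<gamma>)" by simp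
  then have det1: "cmod (\<alpha> * (- \<delta>) - (- \<beta>) * \<gamma>) = 1"
    by (simp only: norm_minus_cancel \<Delta>)
  have "Determinant.det (coeff_mat n F) =
      (\<alpha> * (- \<delta>) - (- \<beta>) * \<gamma>) ^ (n choose 2) * Determinant.det (coeff_mat n G)"
  proof (rule det_coeff_mat_moebius)
    show "degree (F i) < n" if "i < n" for i
    proof -
      have "degree (F i) \<le> sum (degree \<circ> (\<lambda>k. [:- w (Suc i) k, z (Suc i) k:])) ({1..n} - {Suc i})"
        unfolding F_def by (rule degree_prod_sum_le) simp
      also have "\<dots> \<le> (\<Sum>k\<in>{1..n} - {Suc i}. 1)" by (rule sum_mono) auto
      also have "\<dots> < n" using that by simp
      finally show ?thesis .
    qed
    show "degree (G i) < n" if "i < n" for i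
      using degree_gauss_poly[OF n, of q] degree_smult_le[of "R i"]
        degree_pcompose_le[of "gauss_poly n q" "[:0, \<i> * q ^ (2 * a (Suc i)):]"]
      by (auto simp: G_def split: if_splits intro: le_less_trans)
    show "\<alpha> * (- \<delta>) - (- \<beta>) * \<gamma> \<noteq> 0"
      using det1 by (metis norm_zero zero_neq_one)
    show "poly (F i) t = (\<gamma> * t + - \<delta>) ^ (n - 1) * poly (G i) ((\<alpha> * t + - \<beta>) / (\<gamma> * t + - \<delta>))"
      if "i < n" "\<gamma> * t + - \<delta> \<noteq> 0" for i t
      using FR[OF that(1), of t] that(2) by (simp add: G_def poly_pcompose mult_ac)
  qed
  then have "cmod (atiyah_det n z w) = cmod (Determinant.det (coeff_mat n G))"
    by (simp only: atiyah_det_eq_det_coeff_mat F_def[abs_def] norm_mult norm_power det1 power_one mult_1)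
  also have "\<dots> = ((1 / sqrt 2) ^ (n - 1)) ^ n * (\<Prod>j<n. cmod (coeff (gauss_poly n q) j)) * sqrt (real n ^ n)"
    unfolding G_def[abs_def]
  proof (rule cmod_det_gauss_rows[OF R])
    have "q ^ (2 * n) = 1"
      using n by (simp add: q_def Complex.DeMoivre)
    moreover have "(q ^ (2 * a (Suc i))) ^ n = (q ^ (2 * n)) ^ a (Suc i)" for i
      by (simp add: mult_ac flip: power_mult)
    ultimately show "(q ^ (2 * a (Suc i))) ^ n = 1" for i by simp
    have S: "Suc ` {..<n} = {1..n}" by (rule image_Suc_lessThan)
    have "inj_on (a \<circ> Suc) {..<n}"
      by (rule comp_inj_on) (use a in \<open>simp_all only: S bij_betw_imp_inj_on inj_Suc\<close>)
    moreover have "inj_on (\<lambda>k. q ^ (2 * k)) ((a \<circ> Suc) ` {..<n})"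
      unfolding q_def image_comp[symmetric] S bij_betw_imp_surj_on[OF a] by (rule inj_on_roots_of_unity)
    ultimately have "inj_on ((\<lambda>k. q ^ (2 * k)) \<circ> (a \<circ> Suc)) {..<n}"
      by (rule comp_inj_on)
    then show "inj_on (\<lambda>i. q ^ (2 * a (Suc i))) {..<n}"
      by (simp add: comp_def)
  qed
  also have "((1 / sqrt 2) ^ (n - 1)) ^ n = 2 powr (real n * (1 - real n) / 2)"
  proof -
    have "1 / sqrt 2 = (2::real) powr (- 1 / 2)"
      by (simp add: powr_minus_divide powr_half_sqrt)
    then have "((1 / sqrt 2) ^ (n - 1)) ^ n = ((2::real) powr (- 1 / 2)) powr real ((n - 1) * n)"
      by (subst powr_realpow) (simp_all add: power_mult)
    also have "\<dots> = 2 powr (- 1 / 2 * real ((n - 1) * n))"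
      by (rule powr_powr)
    also have "- 1 / 2 * real ((n - 1) * n) = real n * (1 - real n) / 2"
      using n by (simp add: of_nat_diff field_simps)
    finally show ?thesis .
  qed
  also have "sqrt (real n ^ n) = real n powr (real n / 2)"
  proof -
    have "sqrt (real n ^ n) = (real n powr real n) powr (1 / 2)"
      using n by (simp add: powr_half_sqrt powr_realpow)
    also have "\<dots> = real n powr (real n / 2)"
      by (simp add: powr_powr)
    finally show ?thesis .
  qed
  finally show ?thesis
    unfolding q_def prod_cmod_coeff_gauss_poly by (simp add: mult_ac)
qed
end
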